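(* Let $n\in\mathbb{N}_0$. Then for all real $x$ and $\alpha$, $$(n+1)E_{n+1}(x;\alpha)=x\,E_n(x;\alpha)+\frac{\partial E_n(x;\alpha)}{\partial\alpha}+(n+2-x)\,E_n(x-1;\alpha)-\frac{\partial E_n(x-1;\alpha)}{\partial\alpha}.$$
   Context: The uniform B-splines $N_{0,n}$, $n\in\mathbb{N}_0=\{0,1,2,\dots\}$, are defined by $N_{0,0}=1$ on $[0,1)$ and $0$ elsewhere, and the de Boor recurrence $$N_{0,n}(x)=\frac{x}{n}N_{0,n-1}(x)+\frac{n+1-x}{n}N_{1,n-1}(x),\qquad N_{1,n-1}(x):=N_{0,n-1}(x-1),\quad n\ge1.$$ The exponential B-spline of order $n$ with parameter $\alpha$ is $$E_n(x;\alpha)=\sum_{k=0}^{\infty}e^{-\alpha k}N_{0,n}(x-k),$$ a finite sum for each fixed $x$. *)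

theory Defs
  imports "HOL-Analysis.Analysis"
begin

primrec uniform_bspline :: "nat \<Rightarrow> real \<Rightarrow> real" where
  "uniform_bspline 0 x = (if 0 \<le> x \<and> x < 1 then 1 else 0)"
| "uniform_bspline (Suc n) x =
     x / real (Suc n) * uniform_bspline n x +
     (real (Suc n) + 1 - x) / real (Suc n) * uniform_bspline n (x - 1)"

definition exp_bspline :: "nat \<Rightarrow> real \<Rightarrow> real \<Rightarrow> real" where
  "exp_bspline n x \<alpha> = (\<Sum>k. exp (- \<alpha> * real k) * uniform_bspline n (x - real k))"

lemma uniform_bspline_eq_0:
  "x < 0 \<or> real n + 1 \<le> x \<Longrightarrow> uniform_bspline n x = 0"
  by (induction n arbitrary: x) auto

lemma finite_exp_bspline_support:
  "finite {k. exp (- \<alpha> * real k) * uniform_bspline n (x - real k) \<noteq> 0}"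
proof (rule finite_subset)
  show "{k. exp (- \<alpha> * real k) * uniform_bspline n (x - real k) \<noteq> 0} \<subseteq> {..nat \<lfloor>x\<rfloor>}"
  proof
    fix k assume "k \<in> {k. exp (- \<alpha> * real k) * uniform_bspline n (x - real k) \<noteq> 0}"
    then have "\<not> x - real k < 0"
      using uniform_bspline_eq_0[of "x - real k" n] by auto
    then show "k \<in> {..nat \<lfloor>x\<rfloor>}"
      by (simp add: le_nat_floor)
  qed
qed simp

text \<open>The infinite series defining the exponential B-spline is therefore always a finite sum.\<close>

lemma summable_exp_bspline:
  "summable (\<lambda>k. exp (- \<alpha> * real k) * uniform_bspline n (x - real k))"
  by (rule summable_finite[OF finite_exp_bspline_support[of \<alpha> n x]]) auto

end

theory Submission
  imports Defs
begin

text \<open>Since \<open>uniform_bspline\<close> vanishes on negative arguments, any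
  \<open>m\<close> above x truncates the series to k < \<open>m\<close>, uniformly in \<alpha>.
  Differentiating in \<alpha> thus just multiplies the k-th term by -k. Apply the de Boor recurrence
  at x - k: its coefficients depend on k only through x - k = x + (-k) and n + 2 - (x - k) = (n + 2
  - x) - (-k), so the -k parts sum to the two derivatives and the rest to the two spline
  values.\<close>

lemma exp_bspline_eq_sum:
  assumes "x < real m"
  shows "exp_bspline n x \<alpha> = (\<Sum>k<m. exp (- \<alpha> * real k) * uniform_bspline n (x - real k))"
  unfolding exp_bspline_def
proof (rule suminf_finite)
  fix k assume "k \<notin> {..<m}"
  then have "x - real k < 0"
    using assms by (simp add: not_less)
  then show "exp (- \<alpha> * real k) * uniform_bspline n (x - real k) = 0"
    by (simp add: uniform_bspline_eq_0)
qed simp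

text \<open>The range k < \<open>m\<close> is independent of the parameter, so this is termwise
  differentiation of a finite sum of exponentials.\<close>

lemma exp_bspline_has_field_derivative:
  assumes "x < real m"
  shows "((\<lambda>a. exp_bspline n x a) has_field_derivative
           (\<Sum>k<m. - real k * (exp (- \<alpha> * real k) * uniform_bspline n (x - real k)))) (at \<alpha>)"
  unfolding exp_bspline_eq_sum[OF assms]
  by (rule DERIV_sum) (auto intro!: derivative_eq_intros)

theorem theorem6:
  fixes n :: nat and x \<alpha> :: real
  shows "(\<lambda>a. exp_bspline n x a) differentiable (at \<alpha>) \<and>
         (\<lambda>a. exp_bspline n (x - 1) a) differentiable (at \<alpha>) \<and>
         (real n + 1) * exp_bspline (n + 1) x \<alpha> =
           x * exp_bspline n x \<alpha> + deriv (\<lambda>a. exp_bspline n x a) \<alpha> +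
           (real n + 2 - x) * exp_bspline n (x - 1) \<alpha> - deriv (\<lambda>a. exp_bspline n (x - 1) a) \<alpha>"
proof -
  \<comment> \<open>One \<open>m\<close> serves both x and x - 1, so all sums share an index range
    and can be compared termwise.\<close>
  obtain m :: nat where m: "x < real m"
    using reals_Archimedean2 by blast
  then have m': "x - 1 < real m"
    by simp
  note D = exp_bspline_has_field_derivative[OF m, of n \<alpha>]
  note D' = exp_bspline_has_field_derivative[OF m', of n \<alpha>]
  \<comment> \<open>The de Boor recurrence at order n + 1 with its denominator cleared.\<close>
  have recurrence: "(real n + 1) * uniform_bspline (Suc n) y =
      y * uniform_bspline n y + (real n + 2 - y) * uniform_bspline n (y - 1)" for y
  proof -
    have "c * (y / c * u + z / c * v) = y * u + z * v" if "c \<noteq> 0" for c u v z :: real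
      using that by (simp add: distrib_left)
    from this[of "1 + real n" "uniform_bspline n y" "real n + 2 - y" "uniform_bspline n (y - 1)"]
    show ?thesis
      by (simp add: add.commute)
  qed
  have "(real n + 1) * exp_bspline (n + 1) x \<alpha> =
      (\<Sum>k<m. exp (- \<alpha> * real k) * ((real n + 1) * uniform_bspline (Suc n) (x - real k)))"
    \<comment> \<open>The spline of order \<open>Suc n\<close> stays folded so that
      \<open>recurrence\<close> can rewrite it next.\<close>
    by (simp add: exp_bspline_eq_sum[OF m] sum_distrib_left mult.left_commute
        del: uniform_bspline.simps)
  also have "\<dots> = (\<Sum>k<m.
      x * (exp (- \<alpha> * real k) * uniform_bspline n (x - real k)) +
      - real k * (exp (- \<alpha> * real k) * uniform_bspline n (x - real k)) +
      (real n + 2 - x) * (exp (- \<alpha> * real k) * uniform_bspline n (x - 1 - real k)) -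
      - real k * (exp (- \<alpha> * real k) * uniform_bspline n (x - 1 - real k)))"
    unfolding recurrence
  proof (rule sum.cong)
    fix k
    \<comment> \<open>Reading the shifted argument as (x - 1) - k identifies the second group as
      terms of the series at x - 1.\<close>
    have "x - real k - 1 = x - 1 - real k" by simp
    then show "exp (- \<alpha> * real k) * ((x - real k) * uniform_bspline n (x - real k) +
        (real n + 2 - (x - real k)) * uniform_bspline n (x - real k - 1)) =
      x * (exp (- \<alpha> * real k) * uniform_bspline n (x - real k)) +
      - real k * (exp (- \<alpha> * real k) * uniform_bspline n (x - real k)) +
      (real n + 2 - x) * (exp (- \<alpha> * real k) * uniform_bspline n (x - 1 - real k)) -
      - real k * (exp (- \<alpha> * real k) * uniform_bspline n (x - 1 - real k))"
      by (simp only:) (simp add: algebra_simps)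
  qed simp
  also have "\<dots> = x * exp_bspline n x \<alpha> + deriv (\<lambda>a. exp_bspline n x a) \<alpha> +
      (real n + 2 - x) * exp_bspline n (x - 1) \<alpha> - deriv (\<lambda>a. exp_bspline n (x - 1) a) \<alpha>"
    unfolding DERIV_imp_deriv[OF D] DERIV_imp_deriv[OF D']
    by (simp only: sum.distrib sum_subtractf sum_distrib_left
        exp_bspline_eq_sum[OF m] exp_bspline_eq_sum[OF m'])
  finally show ?thesis
    using D D' unfolding real_differentiable_def by blast
qed

end
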